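(* We have \begin{align*} f_n(122)&=\sum_{r=0}^{\lfloor\frac{n-1}{2}\rfloor}\binom{n+r}{3r+1}, \qquad n \geq 1,\\ f_n(211)&=\sum_{j=1}^n\sum_{r=0}^{\lfloor\frac{j-1}{2}\rfloor}\binom{j-1}{2r}\binom{n-r-1}{j-r-1}, \qquad n \geq 1,\\ f_n(111)&=\sum_{k=0}^{\lfloor\frac{n}{2}\rfloor}\binom{n-k}{k}2^{n-k-2}, \qquad n \geq 3. \end{align*}
   Context: A Catalan word of length $n\geq 1$ is an integer sequence $\pi=\pi_1\cdots\pi_n$ with $\pi_1=1$ and $1\leq \pi_{i+1}\leq \pi_i+1$ for $1\leq i\leq n-1$. A (weakly) increasing run of a word is a maximal nondecreasing string of consecutive letters. A Catalan word is flattened if the sequence of first letters of its increasing runs, read from left to right, is nondecreasing. $\mathcal{F}_n$ is the set of flattened Catalan words of length $n$. A word $\pi$ contains a pattern $\tau=\tau_1\cdots\tau_m$ as a consecutive (subword) pattern if some string $\pi_i\pi_{i+1}\cdots\pi_{i+m-1}$ of consecutive letters is order-isomorphic to $\tau$, and avoids $\tau$ otherwise. $f_n(\tau)$ denotes the number of members of $\mathcal{F}_n$ that avoid $\tau$ as a consecutive pattern. *)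

theory Defs
  imports Complex_Main
begin

text \<open>Words are lists of natural numbers. Positions are counted from 0, letters start at 1.\<close>

definition catalan_word :: "nat \<Rightarrow> nat list \<Rightarrow> bool" where
  "catalan_word n w \<longleftrightarrow>
     1 \<le> n \<and> length w = n \<and> w ! 0 = 1 \<and>
     (\<forall>i. i + 1 < n \<longrightarrow> 1 \<le> w ! (i + 1) \<and> w ! (i + 1) \<le> w ! i + 1)"

definition factor :: "'a list \<Rightarrow> nat \<Rightarrow> nat \<Rightarrow> 'a list" where
  "factor w i m = take m (drop i w)"

text \<open>The library predicate \<open>sorted\<close> means weakly increasing, i.e. nondecreasing.\<close>

definition nondecreasing_string :: "nat list \<Rightarrow> nat \<Rightarrow> nat \<Rightarrow> bool" where
  "nondecreasing_string w i j \<longleftrightarrow>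
     i \<le> j \<and> j < length w \<and> sorted (factor w i (j - i + 1))"

text \<open>The letters in positions \<open>i\<close> to \<open>j\<close> (inclusive) form an increasing run:
  they are nondecreasing and no longer nondecreasing string contains them.\<close>

definition increasing_run :: "nat list \<Rightarrow> nat \<Rightarrow> nat \<Rightarrow> bool" where
  "increasing_run w i j \<longleftrightarrow>
     nondecreasing_string w i j \<and>
     (\<forall>i' j'. i' \<le> i \<longrightarrow> j \<le> j' \<longrightarrow> nondecreasing_string w i' j' \<longrightarrow> i' = i \<and> j' = j)"

definition flattened :: "nat list \<Rightarrow> bool" where
  "flattened w \<longleftrightarrow>
     (\<forall>i j i' j'. increasing_run w i j \<longrightarrow> increasing_run w i' j' \<longrightarrow> i < i' \<longrightarrow> w ! i \<le> w ! i')"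

definition flattened_catalan_words :: "nat \<Rightarrow> nat list set" where
  "flattened_catalan_words n = {w. catalan_word n w \<and> flattened w}"

text \<open>As the order is total, preserving and reflecting \<open><\<close> also means that equal letters
  correspond to equal letters.\<close>

definition order_isomorphic :: "nat list \<Rightarrow> nat list \<Rightarrow> bool" where
  "order_isomorphic u v \<longleftrightarrow>
     length u = length v \<and>
     (\<forall>a < length u. \<forall>b < length u. u ! a < u ! b \<longleftrightarrow> v ! a < v ! b)"

definition contains_consecutive :: "nat list \<Rightarrow> nat list \<Rightarrow> bool" where
  "contains_consecutive w p \<longleftrightarrow>
     (\<exists>i. i + length p \<le> length w \<and> order_isomorphic (factor w i (length p)) p)"

definition f_avoiding :: "nat \<Rightarrow> nat list \<Rightarrow> nat" where
  "f_avoiding n p = card {w \<in> flattened_catalan_words n. \<not> contains_consecutive w p}"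

end

theory Submission
  imports Defs
begin

text \<open>
  Each of the three patterns says the same kind of thing: two equal adjacent letters directly
  after a step of a fixed type, an up step for 122, a level step for 111, a descent for 211.
  So a word is read as a sequence of steps, and the only question is when a level step is
  forbidden.

  Read a flattened Catalan word from left to right and remember the last letter \<open>x\<close> and
  the first letter \<open>s\<close> of the current run. The next letter is \<open>x + 1\<close>, or
  \<open>x\<close>, or one of the \<open>x - s\<close> letters in \<open>{s..<x}\<close>; in the last case a new run
  starts, and flatness allows exactly these letters. Only the offset \<open>d = x - s\<close> matters for
  counting, and a descent resets it to \<open>0\<close>. With one bit for a forbidden level step this is the
  recursion of \<open>continuation_count\<close>, and \<open>f_avoiding_eq_continuation_count\<close> reduces the
  theorem to its value at \<open>d = 0\<close>.

  The recursion preserves functions \<open>a + b * d\<close>: the up step shifts \<open>d\<close> by one, and the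
  descents contribute \<open>d\<close> times a constant. Hence for each pattern the counts are linear in
  \<open>d\<close>, and their two coefficients obey a linear recurrence with constant coefficients. In each
  case explicit binomial sums for the coefficients satisfy that recurrence by Pascal's rule
  (\<open>continuation_count_Up\<close>, \<open>continuation_count_Level\<close>, \<open>continuation_count_Down\<close>).
\<close>

section \<open>Run starts\<close>

text \<open>Only adjacent letters need to be compared, which makes it easy to extend a nondecreasing string
  by one letter.\<close>

lemma nondecreasing_string_iff:
  "nondecreasing_string w i j \<longleftrightarrow>
     i \<le> j \<and> j < length w \<and> (\<forall>k. i \<le> k \<longrightarrow> k < j \<longrightarrow> w ! k \<le> w ! Suc k)"
proof (cases "i \<le> j \<and> j < length w")
  case True
  then have len: "length (factor w i (j - i + 1)) = j - i + 1"
    by (auto simp: factor_def min_def)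
  have nth: "factor w i (j - i + 1) ! k = w ! (i + k)" if "k \<le> j - i" for k
    using that True by (simp add: factor_def)
  have "sorted (factor w i (j - i + 1)) \<longleftrightarrow> (\<forall>k. k < j - i \<longrightarrow> w ! (i + k) \<le> w ! Suc (i + k))"
    unfolding sorted_iff_nth_Suc len by (auto simp: nth[simplified])
  also have "\<dots> \<longleftrightarrow> (\<forall>k. i \<le> k \<longrightarrow> k < j \<longrightarrow> w ! k \<le> w ! Suc k)"
  proof (intro iffI allI impI)
    fix k assume a: "\<forall>k. k < j - i \<longrightarrow> w ! (i + k) \<le> w ! Suc (i + k)" "i \<le> k" "k < j"
    then show "w ! k \<le> w ! Suc k" using a(1)[rule_format, of "k - i"] by simp
  qed simp
  finally show ?thesis using True by (simp add: nondecreasing_string_def)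
qed (auto simp: nondecreasing_string_def)

definition descent_bottom :: "nat list \<Rightarrow> nat \<Rightarrow> bool" where
  "descent_bottom w i \<longleftrightarrow> 0 < i \<and> i < length w \<and> w ! i < w ! (i - 1)"

text \<open>A run cannot be prolonged to the left exactly when its first letter is at the beginning of the word
  or below its predecessor; conversely, the longest nondecreasing string that starts at such a
  position is a run.\<close>

lemma increasing_run_starts_iff:
  "(\<exists>j. increasing_run w i j) \<longleftrightarrow> i = 0 \<and> w \<noteq> [] \<or> descent_bottom w i"
proof
  assume "\<exists>j. increasing_run w i j"
  then obtain j where j: "nondecreasing_string w i j"
    and m: "\<And>i' j'. i' \<le> i \<Longrightarrow> j \<le> j' \<Longrightarrow> nondecreasing_string w i' j' \<Longrightarrow> i' = i \<and> j' = j"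
    by (auto simp: increasing_run_def)
  have "w ! i < w ! (i - 1)" if "0 < i"
  proof (rule ccontr)
    assume "\<not> w ! i < w ! (i - 1)"
    have "nondecreasing_string w (i - 1) j"
      unfolding nondecreasing_string_iff
    proof (intro conjI allI impI)
      fix k assume "i - 1 \<le> k" "k < j"
      then show "w ! k \<le> w ! Suc k"
        using j \<open>\<not> w ! i < w ! (i - 1)\<close> \<open>0 < i\<close>
        by (cases "k = i - 1") (auto simp: nondecreasing_string_iff)
    qed (use j in \<open>auto simp: nondecreasing_string_iff\<close>)
    from m[OF _ _ this] \<open>0 < i\<close> show False by simp
  qed
  with j show "i = 0 \<and> w \<noteq> [] \<or> descent_bottom w i"
    by (auto simp: descent_bottom_def nondecreasing_string_iff)
next
  assume i: "i = 0 \<and> w \<noteq> [] \<or> descent_bottom w i"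
  then have "i < length w" by (auto simp: descent_bottom_def)
  define j where "j = (GREATEST j. nondecreasing_string w i j)"
  have ex: "nondecreasing_string w i i"
    using \<open>i < length w\<close> by (simp add: nondecreasing_string_iff)
  have bound: "\<And>j. nondecreasing_string w i j \<Longrightarrow> j \<le> length w"
    by (simp add: nondecreasing_string_iff)
  have j: "nondecreasing_string w i j"
    unfolding j_def using ex bound by (rule GreatestI_nat)
  have max: "j' \<le> j" if "nondecreasing_string w i j'" for j'
    unfolding j_def using that bound by (rule Greatest_le_nat)
  have "increasing_run w i j"
    unfolding increasing_run_def
  proof (intro conjI allI impI)
    fix i' j' assume a: "i' \<le> i" "j \<le> j'" "nondecreasing_string w i' j'"
    have "i \<le> j" using j by (simp add: nondecreasing_string_iff)
    show "i' = i"
    proof (rule ccontr)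
      assume "i' \<noteq> i"
      with a \<open>i \<le> j\<close> have "i' \<le> i - 1" "i - 1 < j'" "Suc (i - 1) = i" by auto
      with a(3) have "w ! (i - 1) \<le> w ! i"
        unfolding nondecreasing_string_iff by metis
      with i \<open>i' \<noteq> i\<close> a show False by (auto simp: descent_bottom_def)
    qed
    with a(2,3) max[of j'] show "j' = j" by auto
  qed (rule j)
  then show "\<exists>j. increasing_run w i j" by blast
qed

section \<open>Words as continuations\<close>

text \<open>Flatness with a lower bound \<open>s\<close> on all later run starts. The bound is the first letter of the
  current run, which may lie before the part of the word that is still to be read.\<close>

definition flat_above :: "nat \<Rightarrow> nat list \<Rightarrow> bool" where
  "flat_above s w \<longleftrightarrow>
     (\<forall>i. descent_bottom w i \<longrightarrow> s \<le> w ! i) \<and>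
     (\<forall>i j. i < j \<longrightarrow> descent_bottom w i \<longrightarrow> descent_bottom w j \<longrightarrow> w ! i \<le> w ! j)"

lemma flattened_iff_flat_above: "flattened (x # us) \<longleftrightarrow> flat_above x (x # us)"
proof -
  let ?w = "x # us"
  have "flattened ?w \<longleftrightarrow>
      (\<forall>i i'. (\<exists>j. increasing_run ?w i j) \<longrightarrow> (\<exists>j'. increasing_run ?w i' j') \<longrightarrow> i < i' \<longrightarrow> ?w ! i \<le> ?w ! i')"
    unfolding flattened_def by blast
  also have "\<dots> \<longleftrightarrow> flat_above x ?w"
    unfolding increasing_run_starts_iff flat_above_def
    by (auto simp: descent_bottom_def)
  finally show ?thesis .
qed

lemma descent_bottom_singleton: "\<not> descent_bottom [x] i"
  by (auto simp: descent_bottom_def)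

lemma descent_bottom_Cons_Cons:
  "descent_bottom (x # y # ys) i \<longleftrightarrow> i = 1 \<and> y < x \<or> (\<exists>k. i = Suc k \<and> descent_bottom (y # ys) k)"
proof (cases i)
  case (Suc k)
  then show ?thesis by (cases k) (auto simp: descent_bottom_def)
qed (simp add: descent_bottom_def)

text \<open>After a descent to \<open>y\<close> the bound becomes \<open>y\<close>. After any other step
  \<open>s \<le> x \<le> y\<close>, so that the condition \<open>s \<le> y\<close> can be stated for all steps alike.\<close>

lemma flat_above_Cons_Cons:
  assumes "s \<le> x"
  shows "flat_above s (x # y # ys) \<longleftrightarrow> s \<le> y \<and> flat_above (if y < x then y else s) (y # ys)"
  (is "?L \<longleftrightarrow> ?R")
proof -
  have pos: "0 < k" if "descent_bottom (y # ys) k" for k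
    using that by (simp add: descent_bottom_def)
  have shift: "descent_bottom (x # y # ys) (Suc k)" if "descent_bottom (y # ys) k" for k
    using that by (simp add: descent_bottom_Cons_Cons)
  have first: "descent_bottom (x # y # ys) 1" if "y < x"
    using that by (simp add: descent_bottom_Cons_Cons)
  show ?thesis
  proof
    assume L: ?L
    have below: "s \<le> (x # y # ys) ! i" if "descent_bottom (x # y # ys) i" for i
      using L that by (simp add: flat_above_def)
    have mono: "(x # y # ys) ! i \<le> (x # y # ys) ! j"
      if "i < j" "descent_bottom (x # y # ys) i" "descent_bottom (x # y # ys) j" for i j
      using L that by (simp add: flat_above_def)
    have "s \<le> y" using below[of 1] first assms by fastforce
    moreover have "(if y < x then y else s) \<le> (y # ys) ! k" if "descent_bottom (y # ys) k" for k
      using below[OF shift[OF that]] mono[of 1 "Suc k", OF _ first shift[OF that]] pos[OF that] by auto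
    moreover have "(y # ys) ! k \<le> (y # ys) ! l"
      if "k < l" "descent_bottom (y # ys) k" "descent_bottom (y # ys) l" for k l
      using mono[of "Suc k" "Suc l", OF _ shift[OF that(2)] shift[OF that(3)]] that(1) by simp
    ultimately show ?R by (simp add: flat_above_def)
  next
    assume R: ?R
    then have sy: "s \<le> y"
      and below: "(if y < x then y else s) \<le> (y # ys) ! k" if "descent_bottom (y # ys) k" for k
      using that by (simp_all add: flat_above_def)
    have mono: "(y # ys) ! k \<le> (y # ys) ! l"
      if "k < l" "descent_bottom (y # ys) k" "descent_bottom (y # ys) l" for k l
      using R that by (simp add: flat_above_def)
    show ?L
      unfolding flat_above_def
    proof (intro conjI allI impI)
      fix i assume "descent_bottom (x # y # ys) i"
      then show "s \<le> (x # y # ys) ! i"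
        using R below by (fastforce simp: descent_bottom_Cons_Cons split: if_splits)
    next
      fix i j assume "i < j" "descent_bottom (x # y # ys) i" "descent_bottom (x # y # ys) j"
      then show "(x # y # ys) ! i \<le> (x # y # ys) ! j"
        using below mono pos by (fastforce simp: descent_bottom_Cons_Cons split: if_splits)
    qed
  qed
qed

datatype step = Up | Level | Down

definition step_of :: "nat \<Rightarrow> nat \<Rightarrow> step" where
  "step_of x y = (if x < y then Up else if x = y then Level else Down)"

definition avoids_level_after :: "step \<Rightarrow> nat list \<Rightarrow> bool" where
  "avoids_level_after T w \<longleftrightarrow>
     (\<forall>i. Suc (Suc i) < length w \<longrightarrow>
        step_of (w ! i) (w ! Suc i) = T \<longrightarrow> w ! Suc i \<noteq> w ! Suc (Suc i))"

lemma avoids_level_after_Cons_Cons: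
  "avoids_level_after T (x # y # ys) \<longleftrightarrow>
     \<not> (step_of x y = T \<and> ys \<noteq> [] \<and> hd ys = y) \<and> avoids_level_after T (y # ys)"
  (is "?L \<longleftrightarrow> ?R")
proof
  assume L: ?L
  show ?R
    using L[unfolded avoids_level_after_def, rule_format, of 0]
      L[unfolded avoids_level_after_def, rule_format, of "Suc i" for i]
    by (auto simp: avoids_level_after_def hd_conv_nth)
next
  assume R: ?R
  show ?L
    unfolding avoids_level_after_def
  proof (intro allI impI)
    fix i assume "Suc (Suc i) < length (x # y # ys)"
      "step_of ((x # y # ys) ! i) ((x # y # ys) ! Suc i) = T"
    then show "(x # y # ys) ! Suc i \<noteq> (x # y # ys) ! Suc (Suc i)"
      using R by (cases i) (auto simp: avoids_level_after_def hd_conv_nth)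
  qed
qed

text \<open>The word \<open>us\<close> may follow the letter \<open>x\<close> if \<open>s\<close> is the first letter of the current run;
  \<open>b\<close> tells whether the step to \<open>x\<close> had type \<open>T\<close>, so that a level step is forbidden now.\<close>

fun continues :: "step \<Rightarrow> bool \<Rightarrow> nat \<Rightarrow> nat \<Rightarrow> nat list \<Rightarrow> bool" where
  "continues T b s x [] \<longleftrightarrow> True"
| "continues T b s x (y # ys) \<longleftrightarrow>
     s \<le> y \<and> y \<le> Suc x \<and> \<not> (b \<and> y = x) \<and>
     continues T (step_of x y = T) (if y < x then y else s) y ys"

definition catalan_steps :: "nat list \<Rightarrow> bool" where
  "catalan_steps w \<longleftrightarrow> (\<forall>i. Suc i < length w \<longrightarrow> w ! Suc i \<le> Suc (w ! i))"

lemma catalan_steps_Cons_Cons: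
  "catalan_steps (x # y # ys) \<longleftrightarrow> y \<le> Suc x \<and> catalan_steps (y # ys)"
  (is "?L \<longleftrightarrow> ?R")
proof
  assume L: ?L
  show ?R
    using L[unfolded catalan_steps_def, rule_format, of 0]
      L[unfolded catalan_steps_def, rule_format, of "Suc i" for i]
    by (auto simp: catalan_steps_def)
next
  assume R: ?R
  show ?L
    unfolding catalan_steps_def
  proof (intro allI impI)
    fix i assume "Suc i < length (x # y # ys)"
    then show "(x # y # ys) ! Suc i \<le> Suc ((x # y # ys) ! i)"
      using R by (cases i) (auto simp: catalan_steps_def)
  qed
qed

lemma continues_iff:
  assumes "s \<le> x"
  shows "continues T b s x us \<longleftrightarrow>
    catalan_steps (x # us) \<and> flat_above s (x # us) \<and> avoids_level_after T (x # us) \<and>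
    \<not> (b \<and> us \<noteq> [] \<and> hd us = x)"
  using assms
proof (induction us arbitrary: b s x)
  case Nil
  then show ?case
    by (simp add: catalan_steps_def flat_above_def descent_bottom_singleton avoids_level_after_def)
next
  case (Cons y ys)
  show ?case
  proof (cases "s \<le> y")
    case True
    then have "(if y < x then y else s) \<le> y" by simp
    from Cons.IH[OF this] True Cons.prems show ?thesis
      by (auto simp: catalan_steps_Cons_Cons flat_above_Cons_Cons avoids_level_after_Cons_Cons)
  qed (use Cons.prems in \<open>simp add: flat_above_Cons_Cons\<close>)
qed

text \<open>Since the first run starts with \<open>1\<close>, the positivity of the letters of a Catalan word follows
  from flatness.\<close>

lemma continues_lower_bound: "continues T b s x us \<Longrightarrow> y \<in> set us \<Longrightarrow> s \<le> y"
  by (induction us arbitrary: b s x) (fastforce split: if_splits)+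

lemma catalan_word_Suc_iff:
  "catalan_word (Suc n) w \<longleftrightarrow>
     (\<exists>us. w = 1 # us \<and> length us = n \<and> catalan_steps w \<and> (\<forall>y\<in>set us. 1 \<le> y))"
proof (cases w)
  case (Cons x us)
  have "(\<forall>y\<in>set us. 1 \<le> y) \<longleftrightarrow> (\<forall>i. i < length us \<longrightarrow> 1 \<le> us ! i)"
    by (auto simp: all_set_conv_all_nth)
  then show ?thesis
    using Cons by (auto simp: catalan_word_def catalan_steps_def)
qed (simp add: catalan_word_def)

lemma contains_consecutive_3_iff:
  assumes "\<And>x y z. order_isomorphic [x, y, z] [a, b, c] \<longleftrightarrow> step_of x y = T \<and> y = z"
  shows "contains_consecutive w [a, b, c] \<longleftrightarrow> \<not> avoids_level_after T w"
proof -
  have "factor w i 3 = [w ! i, w ! Suc i, w ! Suc (Suc i)]" if "i + 3 \<le> length w" for i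
    using that by (auto simp: factor_def list_eq_iff_nth_eq nth_Cons' numeral_3_eq_3 less_Suc_eq)
  then show ?thesis
    unfolding contains_consecutive_def avoids_level_after_def
    by (fastforce simp: assms numeral_3_eq_3 Suc_le_eq)
qed

lemma order_isomorphic_3_iff:
  "order_isomorphic [x, y, z] [a, b, c] \<longleftrightarrow>
     (x < y \<longleftrightarrow> a < b) \<and> (y < x \<longleftrightarrow> b < a) \<and> (y < z \<longleftrightarrow> b < c) \<and> (z < y \<longleftrightarrow> c < b) \<and>
     (x < z \<longleftrightarrow> a < c) \<and> (z < x \<longleftrightarrow> c < a)"
  by (auto simp: order_isomorphic_def All_less_Suc2)

lemma contains_consecutive_122_iff:
  "contains_consecutive w [1, 2, 2] \<longleftrightarrow> \<not> avoids_level_after Up w"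
  by (rule contains_consecutive_3_iff) (auto simp: order_isomorphic_3_iff step_of_def)

lemma contains_consecutive_211_iff:
  "contains_consecutive w [2, 1, 1] \<longleftrightarrow> \<not> avoids_level_after Down w"
  by (rule contains_consecutive_3_iff) (auto simp: order_isomorphic_3_iff step_of_def)

lemma contains_consecutive_111_iff:
  "contains_consecutive w [1, 1, 1] \<longleftrightarrow> \<not> avoids_level_after Level w"
  by (rule contains_consecutive_3_iff) (auto simp: order_isomorphic_3_iff step_of_def)

section \<open>Counting continuations\<close>

definition continuations :: "step \<Rightarrow> nat \<Rightarrow> bool \<Rightarrow> nat \<Rightarrow> nat \<Rightarrow> nat list set" where
  "continuations T n b s x = {us. length us = n \<and> continues T b s x us}"

text \<open>The number of ways to continue by \<open>n\<close> letters when the last letter exceeds the first letter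
  of its run by \<open>d\<close>. The summands belong to the level step, the up step, and the \<open>d\<close> descents.\<close>

fun continuation_count :: "step \<Rightarrow> nat \<Rightarrow> bool \<Rightarrow> nat \<Rightarrow> nat" where
  "continuation_count T 0 b d = 1"
| "continuation_count T (Suc n) b d =
     (if b then 0 else continuation_count T n (T = Level) d)
     + continuation_count T n (T = Up) (Suc d) + d * continuation_count T n (T = Down) 0"

lemma continuations_0: "continuations T 0 b s x = {[]}"
  by (auto simp: continuations_def)

lemma continuations_Suc:
  "continuations T (Suc n) b s x =
     (\<Union>y\<in>{s..Suc x} - (if b then {x} else {}).
        (#) y ` continuations T n (step_of x y = T) (if y < x then y else s) y)"
  (is "_ = ?R")
proof -
  have "us \<in> continuations T (Suc n) b s x \<longleftrightarrow> us \<in> ?R" for us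
    by (cases us) (auto simp: continuations_def)
  then show ?thesis by blast
qed

lemma finite_continuations: "finite (continuations T n b s x)"
  by (induction n arbitrary: b s x) (auto simp: continuations_0 continuations_Suc)

lemma card_continuations:
  assumes "s \<le> x"
  shows "card (continuations T n b s x) = continuation_count T n b (x - s)"
  using assms
proof (induction n arbitrary: b s x)
  case 0
  then show ?case by (simp add: continuations_0)
next
  case (Suc n)
  let ?C = "\<lambda>y. continuations T n (step_of x y = T) (if y < x then y else s) y"
  let ?L = "if b then {} else {x}"
  have split: "{s..Suc x} - (if b then {x} else {}) = {s..<x} \<union> (?L \<union> {Suc x})"
    using Suc.prems by auto
  have "card (continuations T (Suc n) b s x) =
      (\<Sum>y\<in>{s..Suc x} - (if b then {x} else {}). card ((#) y ` ?C y))"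
    unfolding continuations_Suc by (rule card_UN_disjoint) (auto simp: finite_continuations)
  also have "\<dots> = (\<Sum>y\<in>{s..<x} \<union> (?L \<union> {Suc x}). card (?C y))"
    unfolding split by (simp add: card_image)
  also have "\<dots> = (\<Sum>y=s..<x. card (?C y)) + ((\<Sum>y\<in>?L. card (?C y)) + card (?C (Suc x)))"
    by (subst sum.union_disjoint; (subst sum.union_disjoint)?) auto
  also have "(\<Sum>y=s..<x. card (?C y)) = (\<Sum>y=s..<x. continuation_count T n (T = Down) 0)"
    using Suc.IH by (intro sum.cong) (auto simp: step_of_def eq_commute)
  also have "\<dots> = (x - s) * continuation_count T n (T = Down) 0"
    by simp
  also have "(\<Sum>y\<in>?L. card (?C y)) = (if b then 0 else continuation_count T n (T = Level) (x - s))"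
    using Suc.IH[of s x] Suc.prems by (auto simp: step_of_def eq_commute)
  also have "card (?C (Suc x)) = continuation_count T n (T = Up) (Suc (x - s))"
    using Suc.IH[of s "Suc x"] Suc.prems by (auto simp: step_of_def eq_commute Suc_diff_le)
  finally show ?case by simp
qed

lemma f_avoiding_eq_continuation_count:
  assumes "\<And>w. contains_consecutive w p \<longleftrightarrow> \<not> avoids_level_after T w"
  shows "f_avoiding (Suc n) p = continuation_count T n False 0"
proof -
  have "1 \<le> y" if "continues T False 1 1 us" "y \<in> set us" for us y
    using that by (rule continues_lower_bound)
  then have "{w \<in> flattened_catalan_words (Suc n). \<not> contains_consecutive w p}
      = (#) 1 ` continuations T n False 1 1"
    by (auto simp: flattened_catalan_words_def assms catalan_word_Suc_iff flattened_iff_flat_above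
        continuations_def continues_iff)
  then show ?thesis
    by (simp add: f_avoiding_def card_image card_continuations)
qed

section \<open>No level step directly after an up step\<close>

text \<open>If a level step is currently forbidden, only up steps and descents are possible, and the count is
  \<open>up_const n + d * up_slope n\<close>; if it is allowed, the count at \<open>d = 0\<close> is
  \<open>up_total n\<close>. These three families already determine each other: an up step forbids a level
  step, and a descent leads to offset \<open>0\<close> with a level step allowed.

  The terms with \<open>2 * r > n\<close> vanish, so that all sums can share the range \<open>{..n}\<close>, to which
  a further term may be added at will.\<close>

definition up_total :: "nat \<Rightarrow> nat" where
  "up_total n = (\<Sum>r\<le>n. (n + 1 + r) choose (3 * r + 1))"

definition up_const :: "nat \<Rightarrow> nat" where
  "up_const n = (\<Sum>r\<le>n. (n + r) choose (3 * r))"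

definition up_slope :: "nat \<Rightarrow> nat" where
  "up_slope n = (\<Sum>r\<le>n. (n + 1 + r) choose (3 * r + 2))"

lemma up_slope_Suc: "up_slope (Suc n) = up_slope n + up_total n"
proof -
  have "up_slope (Suc n) = (\<Sum>r\<le>n. Suc (n + 1 + r) choose Suc (3 * r + 1))"
    by (simp add: up_slope_def binomial_eq_0)
  also have "\<dots> = up_slope n + up_total n"
    unfolding binomial_Suc_Suc by (simp add: up_slope_def up_total_def sum.distrib)
  finally show ?thesis .
qed

lemma up_const_Suc: "up_const (Suc n) = up_const n + up_slope n"
proof -
  have "up_const n = (\<Sum>r\<le>Suc n. (n + r) choose (3 * r))"
    by (simp add: up_const_def binomial_eq_0)
  also have "\<dots> = 1 + (\<Sum>r\<le>n. (n + 1 + r) choose (3 * r + 3))"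
    by (subst sum.atMost_Suc_shift) (simp add: algebra_simps)
  finally have n: "up_const n = \<dots>" .
  have "up_const (Suc n) = 1 + (\<Sum>r\<le>n. Suc (n + 1 + r) choose Suc (3 * r + 2))"
    unfolding up_const_def
    by (subst sum.atMost_Suc_shift) (simp add: numeral_3_eq_3 del: binomial_Suc_Suc)
  also have "\<dots> = up_const n + up_slope n"
    unfolding binomial_Suc_Suc n
    by (simp add: up_slope_def sum.distrib numeral_3_eq_3 del: binomial_Suc_Suc)
  finally show ?thesis .
qed

lemma up_total_Suc: "up_total (Suc n) = up_total n + up_const (Suc n)"
proof -
  have "up_total (Suc n) = (\<Sum>r\<le>Suc n. Suc (n + 1 + r) choose Suc (3 * r))"
    by (simp add: up_total_def)
  also have "\<dots> = (\<Sum>r\<le>Suc n. (n + 1 + r) choose (3 * r)) + (\<Sum>r\<le>Suc n. (n + 1 + r) choose (3 * r + 1))"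
    unfolding binomial_Suc_Suc by (simp add: sum.distrib)
  also have "\<dots> = up_total n + up_const (Suc n)"
    by (simp add: up_total_def up_const_def binomial_eq_0)
  finally show ?thesis .
qed

lemma continuation_count_Up:
  "continuation_count Up n True d = up_const n + d * up_slope n"
  "continuation_count Up n False 0 = up_total n"
proof (induction n arbitrary: d)
  case 0
  { case 1 then show ?case by (simp add: up_const_def up_slope_def) }
  { case 2 then show ?case by (simp add: up_total_def) }
next
  case (Suc n)
  { case 1 then show ?case
      by (simp add: Suc up_const_Suc up_slope_Suc algebra_simps) }
  { case 2 then show ?case
      by (simp add: Suc up_const_Suc up_total_Suc) }
qed

section \<open>No two consecutive level steps\<close>

text \<open>For \<open>m \<ge> 3\<close>, four times the sum in the formula for 111. The factor keeps the exponents from being truncated at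
  \<open>0\<close>, so that the recurrence holds for all \<open>m\<close>.\<close>

definition level_sum :: "nat \<Rightarrow> nat" where
  "level_sum m = (\<Sum>k\<le>m. ((m - k) choose k) * 2 ^ (m - k))"

lemma level_sum_Suc_Suc: "level_sum (Suc (Suc m)) = 2 * level_sum (Suc m) + 2 * level_sum m"
proof -
  \<comment> \<open>The term of index 0 is split off, so that the rest has the form to which Pascal's rule applies.\<close>
  have "level_sum (Suc (Suc m)) = 2 ^ (m + 2) + (\<Sum>k\<le>Suc m. ((Suc m - k) choose Suc k) * 2 ^ (Suc m - k))"
    unfolding level_sum_def by (subst sum.atMost_Suc_shift) simp
  also have "(\<Sum>k\<le>Suc m. ((Suc m - k) choose Suc k) * 2 ^ (Suc m - k))
      = (\<Sum>k\<le>m. (Suc (m - k) choose Suc k) * (2 * 2 ^ (m - k)))"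
    by (simp add: Suc_diff_le)
  also have "\<dots> = 2 * level_sum m + 2 * (\<Sum>k\<le>m. ((m - k) choose Suc k) * 2 ^ (m - k))"
    by (simp add: level_sum_def sum.distrib sum_distrib_left algebra_simps)
  also have "2 ^ (m + 2) + \<dots> = 2 * level_sum (Suc m) + 2 * level_sum m"
    unfolding level_sum_def[of "Suc m"] by (subst sum.atMost_Suc_shift) simp
  finally show ?thesis .
qed

text \<open>After a level step the next step is an up step or a descent, and after these a level step is allowed
  again. Unfolding twice therefore gives a recurrence in the unrestricted counts alone, and on
  multiples of \<open>d + 1\<close> it becomes \<open>level_sum_Suc_Suc\<close>. The counts are multiples of
  \<open>d + 1\<close> only from length \<open>2\<close> on; for length \<open>0\<close> the count is \<open>1\<close> and for
  length \<open>1\<close> it is \<open>d + 2\<close>.\<close>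

lemma continuation_count_Level:
  "4 * continuation_count Level (n + 2) False d = level_sum (n + 3) * (d + 1)"
proof (induction n arbitrary: d rule: induct_nat_012)
  case 0
  then show ?case by (simp add: numeral_eq_Suc level_sum_def)
next
  case 1
  then show ?case by (simp add: numeral_eq_Suc level_sum_def)
next
  case (ge2 n)
  let ?c = "\<lambda>n. continuation_count Level n False"
  have "4 * ?c (Suc (Suc n) + 2) d
      = 4 * ?c (n + 2) (Suc d) + d * (4 * ?c (n + 2) 0) + 4 * ?c (Suc n + 2) (Suc d) + d * (4 * ?c (Suc n + 2) 0)"
    by (simp add: algebra_simps)
  also have "\<dots> = level_sum (Suc (Suc (n + 3))) * (d + 1)"
    unfolding ge2 level_sum_Suc_Suc by (simp add: algebra_simps)
  finally show ?case by simp
qed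

section \<open>No level step directly after a descent\<close>

text \<open>With \<open>r\<close> descents and \<open>j = r + i\<close> steps that are not level, the level steps of a step word
  of length \<open>n\<close> can be placed in \<open>(n - r) choose i\<close> ways, since none of them may follow a
  descent directly. The words of \<open>j\<close> steps that are not level, \<open>r\<close> of them descents, starting at
  offset \<open>0\<close>, number \<open>j choose (2 * r)\<close>: a descent has as many targets as there are up steps since
  the previous descent, so it amounts to marking one of these and the descent itself.
  Summing over \<open>i\<close> gives \<open>shifted_vandermonde (n - r) r (2 * r)\<close>.
  Pascal's rule for either factor yields a recurrence of this function, and these two recurrences
  replace all further work with binomial coefficients.\<close>

definition shifted_vandermonde :: "nat \<Rightarrow> nat \<Rightarrow> nat \<Rightarrow> nat" where
  "shifted_vandermonde m p q = (\<Sum>i\<le>m. ((p + i) choose q) * (m choose i))"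

lemma shifted_vandermonde_Suc:
  "shifted_vandermonde (Suc m) p q = shifted_vandermonde m p q + shifted_vandermonde m (Suc p) q"
proof -
  have "shifted_vandermonde (Suc m) p q
      = (p choose q) + (\<Sum>i\<le>m. ((Suc p + i) choose q) * (Suc m choose Suc i))"
    unfolding shifted_vandermonde_def by (subst sum.atMost_Suc_shift) simp
  also have "\<dots> = ((p choose q) + (\<Sum>i\<le>m. ((Suc p + i) choose q) * (m choose Suc i)))
      + shifted_vandermonde m (Suc p) q"
    by (simp add: shifted_vandermonde_def sum.distrib algebra_simps)
  also have "(p choose q) + (\<Sum>i\<le>m. ((Suc p + i) choose q) * (m choose Suc i))
      = (\<Sum>i\<le>Suc m. ((p + i) choose q) * (m choose i))"
    by (subst sum.atMost_Suc_shift) simp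
  also have "\<dots> = shifted_vandermonde m p q"
    by (simp add: shifted_vandermonde_def)
  finally show ?thesis .
qed

lemma shifted_vandermonde_Suc_Suc:
  "shifted_vandermonde m (Suc p) (Suc q) = shifted_vandermonde m p (Suc q) + shifted_vandermonde m p q"
  by (simp add: shifted_vandermonde_def sum.distrib algebra_simps)

lemma shifted_vandermonde_0_0: "shifted_vandermonde m p 0 = 2 ^ m"
  by (simp add: shifted_vandermonde_def choose_row_sum)

lemma shifted_vandermonde_eq_0: "p < q \<Longrightarrow> shifted_vandermonde 0 p q = 0"
  by (simp add: shifted_vandermonde_def)

text \<open>Intercept and slope of the count as a function of \<open>d\<close>. They differ in the parity of the lower
  index: \<open>2 * r\<close> in the intercept, \<open>2 * r - 1\<close> in the slope, where \<open>r \<ge> 1\<close> is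
  replaced by \<open>Suc r\<close>.\<close>

definition down_const :: "nat \<Rightarrow> nat" where
  "down_const n = (\<Sum>r\<le>n. shifted_vandermonde (n - r) r (2 * r))"

definition down_slope :: "nat \<Rightarrow> nat" where
  "down_slope n = (\<Sum>r<n. shifted_vandermonde (n - Suc r) (Suc r) (Suc (2 * r)))"

text \<open>The recurrences of both coefficients lead to this sum, because
  \<open>shifted_vandermonde_Suc_Suc\<close> splits its terms into one of even and one of odd index. At
  \<open>r = 0\<close> there is no odd term.\<close>

lemma sum_shifted_vandermonde_Suc_even:
  "(\<Sum>r\<le>n. shifted_vandermonde (n - r) (Suc r) (2 * r)) = down_const n + down_slope n"
proof -
  have "shifted_vandermonde (n - r) (Suc r) (2 * r) = shifted_vandermonde (n - r) r (2 * r)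
      + (if r = 0 then 0 else shifted_vandermonde (n - r) r (2 * r - 1))" for r
    by (cases r) (simp_all add: shifted_vandermonde_0_0 shifted_vandermonde_Suc_Suc)
  then have "(\<Sum>r\<le>n. shifted_vandermonde (n - r) (Suc r) (2 * r)) = down_const n
      + (\<Sum>r\<le>n. if r = 0 then 0 else shifted_vandermonde (n - r) r (2 * r - 1))"
    by (simp add: down_const_def sum.distrib)
  also have "(\<Sum>r\<le>n. if r = 0 then 0 else shifted_vandermonde (n - r) r (2 * r - 1)) = down_slope n"
    by (subst sum.atMost_shift) (simp add: down_slope_def)
  finally show ?thesis .
qed

lemma down_const_Suc: "down_const (Suc n) = 2 * down_const n + down_slope n"
proof -
  have "down_const (Suc n) = (\<Sum>r\<le>n. shifted_vandermonde (Suc (n - r)) r (2 * r))"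
    by (simp add: down_const_def shifted_vandermonde_eq_0 Suc_diff_le)
  also have "\<dots> = 2 * down_const n + down_slope n"
    unfolding shifted_vandermonde_Suc sum.distrib sum_shifted_vandermonde_Suc_even
    by (simp add: down_const_def)
  finally show ?thesis .
qed

lemma down_slope_Suc_Suc:
  "down_slope (Suc (Suc n)) = 2 * down_slope (Suc n) + down_const n + down_slope n"
proof -
  have "down_slope (Suc (Suc n)) = (\<Sum>r\<le>n. shifted_vandermonde (Suc (n - r)) (Suc r) (Suc (2 * r)))"
    by (simp add: down_slope_def lessThan_Suc_atMost shifted_vandermonde_eq_0 Suc_diff_le)
  also have "\<dots> = 2 * down_slope (Suc n) + (\<Sum>r\<le>n. shifted_vandermonde (n - r) (Suc r) (2 * r))"
    unfolding shifted_vandermonde_Suc shifted_vandermonde_Suc_Suc[of _ "Suc _"] sum.distrib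
    by (simp add: down_slope_def lessThan_Suc_atMost)
  also have "(\<Sum>r\<le>n. shifted_vandermonde (n - r) (Suc r) (2 * r)) = down_const n + down_slope n"
    by (rule sum_shifted_vandermonde_Suc_even)
  finally show ?thesis by simp
qed

text \<open>A level step is forbidden only directly after a descent, hence at offset \<open>0\<close>, where only the up
  step to offset \<open>1\<close> remains. So a descent followed by \<open>n + 1\<close> letters is counted by the
  unrestricted count for \<open>n\<close> letters at offset \<open>1\<close>, and the recurrence has order two.\<close>

lemma continuation_count_Down:
  "continuation_count Down n False d = down_const n + d * down_slope n"
proof -
  have "(\<forall>d. continuation_count Down n False d = down_const n + d * down_slope n) \<and>
    (\<forall>d. continuation_count Down (Suc n) False d = down_const (Suc n) + d * down_slope (Suc n))"
  proof (induction n)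
    case 0
    show ?case
      by (simp add: down_const_def down_slope_def shifted_vandermonde_def numeral_2_eq_2)
  next
    case (Suc n)
    have "continuation_count Down (Suc n) True 0 = down_const n + down_slope n"
      using Suc by simp
    then show ?case
      using Suc by (auto simp: down_const_Suc down_slope_Suc_Suc algebra_simps
          simp del: continuation_count.simps(2)
          simp: continuation_count.simps(2)[of _ "Suc _"])
  qed
  then show ?thesis by simp
qed

lemma down_const_eq:
  "down_const n = (\<Sum>j\<le>n. \<Sum>r\<le>j div 2. (j choose (2 * r)) * ((n - r) choose (j - r)))"
proof -
  have "down_const n = (\<Sum>r\<le>n. \<Sum>i\<le>n - r. ((r + i) choose (2 * r)) * ((n - r) choose i))"
    by (simp add: down_const_def shifted_vandermonde_def)
  also have "\<dots> = (\<Sum>r\<le>n. \<Sum>j=r..n. (j choose (2 * r)) * ((n - r) choose (j - r)))"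
  proof (rule sum.cong)
    fix r assume "r \<in> {..n}"
    then show "(\<Sum>i\<le>n - r. ((r + i) choose (2 * r)) * ((n - r) choose i))
        = (\<Sum>j=r..n. (j choose (2 * r)) * ((n - r) choose (j - r)))"
      by (intro sum.reindex_bij_witness[of _ "\<lambda>j. j - r" "\<lambda>i. r + i"]) auto
  qed simp
  also have "\<dots> = (\<Sum>r\<le>n. \<Sum>j | j \<in> {..n} \<and> r \<le> j. (j choose (2 * r)) * ((n - r) choose (j - r)))"
    by (intro sum.cong) auto
  also have "\<dots> = (\<Sum>j\<le>n. \<Sum>r | r \<in> {..n} \<and> r \<le> j. (j choose (2 * r)) * ((n - r) choose (j - r)))"
    by (rule sum.swap_restrict) simp_all
  also have "\<dots> = (\<Sum>j\<le>n. \<Sum>r\<le>j. (j choose (2 * r)) * ((n - r) choose (j - r)))"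
    by (intro sum.cong) auto
  also have "\<dots> = (\<Sum>j\<le>n. \<Sum>r\<le>j div 2. (j choose (2 * r)) * ((n - r) choose (j - r)))"
    by (intro sum.cong refl sum.mono_neutral_right) (auto simp: binomial_eq_0)
  finally show ?thesis .
qed

section \<open>The three formulas\<close>

theorem corollary2p3:
  shows "(\<forall>n::nat. n \<ge> 1 \<longrightarrow>
            f_avoiding n [1, 2, 2] = (\<Sum>r = 0..(n - 1) div 2. (n + r) choose (3 * r + 1)))
       \<and> (\<forall>n::nat. n \<ge> 1 \<longrightarrow>
            f_avoiding n [2, 1, 1] = (\<Sum>j = 1..n. \<Sum>r = 0..(j - 1) div 2.
                               ((j - 1) choose (2 * r)) * ((n - r - 1) choose (j - r - 1))))
       \<and> (\<forall>n::nat. n \<ge> 3 \<longrightarrow>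
            f_avoiding n [1, 1, 1] = (\<Sum>k = 0..n div 2. ((n - k) choose k) * 2 ^ (n - k - 2)))"
proof (intro conjI allI impI)
  fix n :: nat assume "n \<ge> 1"
  then obtain m where n: "n = Suc m" by (cases n) auto
  have "f_avoiding n [1, 2, 2] = up_total m"
    unfolding n f_avoiding_eq_continuation_count[OF contains_consecutive_122_iff]
    by (rule continuation_count_Up)
  also have "\<dots> = (\<Sum>r = 0..(n - 1) div 2. (n + r) choose (3 * r + 1))"
    unfolding up_total_def n by (intro sum.mono_neutral_cong_right) (auto simp: binomial_eq_0)
  finally show "f_avoiding n [1, 2, 2] = \<dots>" .
next
  fix n :: nat assume "n \<ge> 1"
  then obtain m where n: "n = Suc m" by (cases n) auto
  have "f_avoiding n [2, 1, 1] = down_const m"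
    unfolding n f_avoiding_eq_continuation_count[OF contains_consecutive_211_iff]
    by (simp add: continuation_count_Down)
  also have "\<dots> = (\<Sum>j = 1..n. \<Sum>r = 0..(j - 1) div 2.
      ((j - 1) choose (2 * r)) * ((n - r - 1) choose (j - r - 1)))"
    unfolding down_const_eq n
    by (rule sum.reindex_bij_witness[of _ "\<lambda>j. j - 1" Suc])
      (auto simp: atLeast0AtMost intro!: sum.cong)
  finally show "f_avoiding n [2, 1, 1] = \<dots>" .
next
  \<comment> \<open>At least two letters must follow the initial 1, because the count is a multiple of d + 1 only from there on.\<close>
  fix n :: nat assume "n \<ge> 3"
  define m where "m = n - 3"
  with \<open>n \<ge> 3\<close> have n: "n = Suc (m + 2)" by simp
  have "4 * f_avoiding n [1, 1, 1] = level_sum n"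
    unfolding n f_avoiding_eq_continuation_count[OF contains_consecutive_111_iff]
      continuation_count_Level by (simp add: numeral_3_eq_3)
  also have "\<dots> = (\<Sum>k = 0..n div 2. ((n - k) choose k) * 2 ^ (n - k))"
    unfolding level_sum_def by (rule sum.mono_neutral_right) (auto simp: binomial_eq_0)
  also have "\<dots> = (\<Sum>k = 0..n div 2. 4 * (((n - k) choose k) * 2 ^ (n - k - 2)))"
  proof (rule sum.cong)
    fix k assume "k \<in> {0..n div 2}"
    then have "n - k = Suc (Suc (n - k - 2))" using \<open>n \<ge> 3\<close> by auto
    then have "(2::nat) ^ (n - k) = 2 ^ Suc (Suc (n - k - 2))" by (rule arg_cong)
    then show "((n - k) choose k) * 2 ^ (n - k) = 4 * (((n - k) choose k) * 2 ^ (n - k - 2))"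
      by simp
  qed simp
  also have "\<dots> = 4 * (\<Sum>k = 0..n div 2. ((n - k) choose k) * 2 ^ (n - k - 2))"
    by (simp add: sum_distrib_left)
  finally show "f_avoiding n [1, 1, 1] = (\<Sum>k = 0..n div 2. ((n - k) choose k) * 2 ^ (n - k - 2))"
    by simp
qed

end
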